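(* Let $\mathcal{V}$ be a strongly irregular variety of a plural type (possibly with constants) and let $\mathbf{A}$ be the P\l onka sum over a semilattice direct system $\mathbb{A}=(\{\mathbf{A}_i\}_{i\in I},(I,\le),\{p_{ij}\}_{i\le j})$ of algebras in $\mathcal{V}$. Let $R\subseteq A\times A$, $R_{uv}:=R\cap(A_u\times A_v)$, $S_R:=\{(u,v)\in I\times I\mid R_{uv}\neq\emptyset\}$, and let $C\in Con(\mathbf{I})$ be such that $S_R\subseteq C$. For $i\in I$ let $\Psi_i$ be the congruence of $\mathbf{A}_i$ generated by $\bigcup_{u,v\le i}(p_{ui}\times p_{vi})(R_{uv})$, and let $S_C^{\Psi}:=\{(i,j)\in C\mid (p_{i,i\vee j}\times p_{j,i\vee j})^{-1}(\Psi_{i\vee j})\ne\emptyset\}$. For every $i\in I$ define a binary relation $\theta_{ii}$ on $A_i$ by: $(a,b)\in\theta_{ii}$ if and only if there exists $k\in I$ with $i\le k$, $(i,k)\in S_C^{\Psi}$ and $(p_{ik}(a),p_{ik}(b))\in\Psi_k$. Then $\theta_{ii}\in Con(\mathbf{A}_i)$ for every $i\in I$, $(C,\{\theta_{ii}\}_{i\in I})$ is a congruence on the direct system $\mathbb{A}$, and its associated congruence $\theta$ on $\mathbf{A}$ satisfies $R\subseteq\theta$. In particular, for every $C\in Con(\mathbf{I})$ there exists $\theta\in Con(\mathbf{A})$ such that $C_\theta=C$.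
   Context: A type is plural if it contains at least one operation symbol of arity at least $2$. A variety $\mathcal{V}$ is strongly irregular if there is a binary term $f(x,y)$, in which both variables actually occur, such that $\mathcal{V}\models f(x,y)\approx x$. A semilattice direct system $\mathbb{A}=(\{\mathbf{A}_i\}_{i\in I},(I,\le),\{p_{ij}\}_{i\le j})$ consists of a join-semilattice $\mathbf{I}=(I,\le)$ with join $\vee$ (required to have a least element $i_0$ when the type contains constants), algebras $\mathbf{A}_i$ of the same type with pairwise disjoint universes, and homomorphisms $p_{ij}\colon\mathbf{A}_i\to\mathbf{A}_j$ for $i\le j$ with $p_{ii}=\mathrm{id}$ and $p_{ik}=p_{jk}\circ p_{ij}$ for $i\le j\le k$. Its P\l onka sum is the algebra with universe $A=\bigcup_{i\in I}A_i$ in which, for every $n$-ary operation $g$ with $n\ge1$ and $a_1\in A_{i_1},\dots,a_n\in A_{i_n}$, $g(a_1,\dots,a_n)=g^{\mathbf{A}_j}(p_{i_1j}(a_1),\dots,p_{i_nj}(a_n))$ with $j=i_1\vee\dots\vee i_n$, and every constant $c$ is interpreted as $c^{\mathbf{A}_{i_0}}$. Notation: $(p\times q)(a,b)=(p(a),q(b))$. Given $C\in Con(\mathbf{I})$ and a family $\theta_{ii}\in Con(\mathbf{A}_i)$, let $S_C^{\theta}:=\{(i,j)\in C\mid (p_{i,i\vee j}\times p_{j,i\vee j})^{-1}(\theta_{i\vee j,i\vee j})\ne\emptyset\}$. A congruence on $\mathbb{A}$ is a pair $(C,\{\theta_{ii}\}_{i\in I})$ such that: (i) $C\in Con(\mathbf{I})$;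 (ii) $\theta_{ii}\in Con(\mathbf{A}_i)$ for every $i$; (iii) $\theta_{ii}\subseteq(p_{i,i\vee j}\times p_{i,i\vee j})^{-1}(\theta_{i\vee j,i\vee j})$ for all $i,j\in I$; (iv) equality holds in (iii) for all $(i,j)\in S_C^{\theta}$. Its associated congruence on $\mathbf{A}$ is $\theta:=\bigcup_{(i,j)\in S_C^{\theta}}(p_{i,i\vee j}\times p_{j,i\vee j})^{-1}(\theta_{i\vee j,i\vee j})$ (for $i=j$ this is $\theta_{ii}$); it is known to be a congruence of $\mathbf{A}$. For $\theta\in Con(\mathbf{A})$: $S_\theta:=\{(i,j)\in I\times I\mid\theta\cap(A_i\times A_j)\neq\emptyset\}$ and $C_\theta:=\{(i,j)\in I\times I\mid (i,i\vee j),(j,i\vee j)\in S_\theta\}$. *)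

theory Defs
  imports Main
begin

text \<open>A type of algebras is an arity function \<open>ar :: 'f \<Rightarrow> nat\<close>; every element of \<open>'f\<close> is an
  operation symbol, and the symbols of arity \<open>0\<close> are the constants. An operation takes its
  arguments as a list; it is only meaningful on lists of the right length over the universe.\<close>

record ('f, 'a) alg =
  univ :: "'a set"
  oper :: "'f \<Rightarrow> 'a list \<Rightarrow> 'a"

definition algebra :: "('f \<Rightarrow> nat) \<Rightarrow> ('f, 'a) alg \<Rightarrow> bool" where
  "algebra ar M \<longleftrightarrow> univ M \<noteq> {} \<and>
     (\<forall>f as. length as = ar f \<longrightarrow> set as \<subseteq> univ M \<longrightarrow> oper M f as \<in> univ M)"

definition plural :: "('f \<Rightarrow> nat) \<Rightarrow> bool" where
  "plural ar \<longleftrightarrow> (\<exists>f. 2 \<le> ar f)"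

definition has_constants :: "('f \<Rightarrow> nat) \<Rightarrow> bool" where
  "has_constants ar \<longleftrightarrow> (\<exists>f. ar f = 0)"

definition alg_hom ::
  "('f \<Rightarrow> nat) \<Rightarrow> ('f, 'a) alg \<Rightarrow> ('f, 'b) alg \<Rightarrow> ('a \<Rightarrow> 'b) \<Rightarrow> bool" where
  "alg_hom ar M N h \<longleftrightarrow> (\<forall>a\<in>univ M. h a \<in> univ N) \<and>
     (\<forall>f as. length as = ar f \<longrightarrow> set as \<subseteq> univ M \<longrightarrow>
        h (oper M f as) = oper N f (map h as))"

definition Con :: "('f \<Rightarrow> nat) \<Rightarrow> ('f, 'a) alg \<Rightarrow> 'a rel set" where
  "Con ar M = {\<theta>. equiv (univ M) \<theta> \<and>
     (\<forall>f as bs. length as = ar f \<longrightarrow> length bs = ar f \<longrightarrow>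
        list_all2 (\<lambda>a b. (a, b) \<in> \<theta>) as bs \<longrightarrow> (oper M f as, oper M f bs) \<in> \<theta>)}"

definition gen_con :: "('f \<Rightarrow> nat) \<Rightarrow> ('f, 'a) alg \<Rightarrow> 'a rel \<Rightarrow> 'a rel" where
  "gen_con ar M X = \<Inter>{\<theta> \<in> Con ar M. X \<subseteq> \<theta>}"

datatype (syms: 'f, vars: 'v) trm = Var 'v | App 'f "('f, 'v) trm list"

fun wf_trm :: "('f \<Rightarrow> nat) \<Rightarrow> ('f, 'v) trm \<Rightarrow> bool" where
  "wf_trm ar (Var x) \<longleftrightarrow> True"
| "wf_trm ar (App f ts) \<longleftrightarrow> length ts = ar f \<and> (\<forall>t\<in>set ts. wf_trm ar t)"

fun eval_trm :: "('f, 'a) alg \<Rightarrow> ('v \<Rightarrow> 'a) \<Rightarrow> ('f, 'v) trm \<Rightarrow> 'a" where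
  "eval_trm M \<sigma> (Var x) = \<sigma> x"
| "eval_trm M \<sigma> (App f ts) = oper M f (map (eval_trm M \<sigma>) ts)"

definition satisfies :: "('f, 'a) alg \<Rightarrow> ('f, 'v) trm \<Rightarrow> ('f, 'v) trm \<Rightarrow> bool" where
  "satisfies M s t \<longleftrightarrow> (\<forall>\<sigma>. range \<sigma> \<subseteq> univ M \<longrightarrow> eval_trm M \<sigma> s = eval_trm M \<sigma> t)"

text \<open>Varieties are equational classes, with identities over countably many variables. As a class
  of algebras cannot range over all carrier types at once, \<open>V\<close> consists of the models whose
  universe is a subset of the type \<open>'a\<close>. Hence \<open>strongly_irregular\<close> only demands its identity
  in these models, which is implied by demanding it in all models.\<close>

definition variety :: "('f \<Rightarrow> nat) \<Rightarrow> ('f, 'a) alg set \<Rightarrow> bool" where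
  "variety ar V \<longleftrightarrow> (\<exists>E :: (('f, nat) trm \<times> ('f, nat) trm) set.
     (\<forall>(s, t)\<in>E. wf_trm ar s \<and> wf_trm ar t) \<and>
     V = {M. algebra ar M \<and> (\<forall>(s, t)\<in>E. satisfies M s t)})"

definition strongly_irregular :: "('f \<Rightarrow> nat) \<Rightarrow> ('f, 'a) alg set \<Rightarrow> bool" where
  "strongly_irregular ar V \<longleftrightarrow> (\<exists>t :: ('f, nat) trm.
     wf_trm ar t \<and> vars t = {0, 1} \<and> (\<forall>M\<in>V. satisfies M t (Var 0)))"

text \<open>The join-semilattice of indices is a type of class \<open>semilattice_sup\<close>. The maps \<open>p i j\<close> are
  only relevant for \<open>i \<le> j\<close> and on the universe of \<open>A i\<close>.\<close>

definition direct_system ::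
  "('f \<Rightarrow> nat) \<Rightarrow> ('i::semilattice_sup \<Rightarrow> ('f, 'a) alg) \<Rightarrow> ('i \<Rightarrow> 'i \<Rightarrow> 'a \<Rightarrow> 'a) \<Rightarrow> bool" where
  "direct_system ar A p \<longleftrightarrow>
     (has_constants ar \<longrightarrow> (\<exists>i\<^sub>0::'i. \<forall>i. i\<^sub>0 \<le> i)) \<and>
     (\<forall>i. algebra ar (A i)) \<and>
     (\<forall>i j. i \<noteq> j \<longrightarrow> univ (A i) \<inter> univ (A j) = {}) \<and>
     (\<forall>i j. i \<le> j \<longrightarrow> alg_hom ar (A i) (A j) (p i j)) \<and>
     (\<forall>i. \<forall>a\<in>univ (A i). p i i a = a) \<and>
     (\<forall>i j k. i \<le> j \<longrightarrow> j \<le> k \<longrightarrow> (\<forall>a\<in>univ (A i). p i k a = p j k (p i j a)))"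

definition index_of :: "('i \<Rightarrow> ('f, 'a) alg) \<Rightarrow> 'a \<Rightarrow> 'i" where
  "index_of A a = (THE i. a \<in> univ (A i))"

text \<open>The empty argument list is the case of a constant, interpreted in the algebra at the least
  index.\<close>

definition plonka_sum ::
  "('i::semilattice_sup \<Rightarrow> ('f, 'a) alg) \<Rightarrow> ('i \<Rightarrow> 'i \<Rightarrow> 'a \<Rightarrow> 'a) \<Rightarrow> ('f, 'a) alg" where
  "plonka_sum A p =
     \<lparr> univ = (\<Union>i. univ (A i)),
       oper = (\<lambda>f as.
         if as = [] then oper (A (THE i\<^sub>0. \<forall>i. i\<^sub>0 \<le> i)) f []
         else let j = Sup_fin (index_of A ` set as)
              in oper (A j) f (map (\<lambda>a. p (index_of A a) j a) as)) \<rparr>"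

definition semilattice_Con :: "'i::semilattice_sup rel set" where
  "semilattice_Con = {C. equiv UNIV C \<and>
     (\<forall>i j k l. (i, j) \<in> C \<longrightarrow> (k, l) \<in> C \<longrightarrow> (sup i k, sup j l) \<in> C)}"

text \<open>\<open>pull A p i j X\<close> is the preimage of \<open>X\<close> under \<open>p\<^bsub>i,i\<or>j\<^esub> \<times> p\<^bsub>j,i\<or>j\<^esub>\<close>, a subset of
  \<open>A\<^sub>i \<times> A\<^sub>j\<close>.\<close>

definition pull ::
  "('i::semilattice_sup \<Rightarrow> ('f, 'a) alg) \<Rightarrow> ('i \<Rightarrow> 'i \<Rightarrow> 'a \<Rightarrow> 'a) \<Rightarrow> 'i \<Rightarrow> 'i \<Rightarrow> 'a rel \<Rightarrow> 'a rel" where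
  "pull A p i j X = {(a, b). a \<in> univ (A i) \<and> b \<in> univ (A j) \<and>
     (p i (sup i j) a, p j (sup i j) b) \<in> X}"

definition S_fam ::
  "('i::semilattice_sup \<Rightarrow> ('f, 'a) alg) \<Rightarrow> ('i \<Rightarrow> 'i \<Rightarrow> 'a \<Rightarrow> 'a) \<Rightarrow> 'i rel \<Rightarrow> ('i \<Rightarrow> 'a rel) \<Rightarrow> 'i rel" where
  "S_fam A p C \<theta> = {(i, j). (i, j) \<in> C \<and> pull A p i j (\<theta> (sup i j)) \<noteq> {}}"

text \<open>The last two conditions apply \<open>p\<^bsub>i,i\<or>j\<^esub>\<close> in both coordinates, so they are not instances
  of \<open>pull\<close> unless \<open>i = j\<close>.\<close>

definition system_congruence ::
  "('f \<Rightarrow> nat) \<Rightarrow> ('i::semilattice_sup \<Rightarrow> ('f, 'a) alg) \<Rightarrow> ('i \<Rightarrow> 'i \<Rightarrow> 'a \<Rightarrow> 'a) \<Rightarrow>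
    'i rel \<Rightarrow> ('i \<Rightarrow> 'a rel) \<Rightarrow> bool" where
  "system_congruence ar A p C \<theta> \<longleftrightarrow>
     C \<in> semilattice_Con \<and>
     (\<forall>i. \<theta> i \<in> Con ar (A i)) \<and>
     (\<forall>i j. \<theta> i \<subseteq> {(a, b). a \<in> univ (A i) \<and> b \<in> univ (A i) \<and>
        (p i (sup i j) a, p i (sup i j) b) \<in> \<theta> (sup i j)}) \<and>
     (\<forall>(i, j)\<in>S_fam A p C \<theta>. \<theta> i = {(a, b). a \<in> univ (A i) \<and> b \<in> univ (A i) \<and>
        (p i (sup i j) a, p i (sup i j) b) \<in> \<theta> (sup i j)})"

definition assoc_congruence ::
  "('i::semilattice_sup \<Rightarrow> ('f, 'a) alg) \<Rightarrow> ('i \<Rightarrow> 'i \<Rightarrow> 'a \<Rightarrow> 'a) \<Rightarrow> 'i rel \<Rightarrow> ('i \<Rightarrow> 'a rel) \<Rightarrow> 'a rel" where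
  "assoc_congruence A p C \<theta> = (\<Union>(i, j)\<in>S_fam A p C \<theta>. pull A p i j (\<theta> (sup i j)))"

definition S_rel :: "('i \<Rightarrow> ('f, 'a) alg) \<Rightarrow> 'a rel \<Rightarrow> 'i rel" where
  "S_rel A R = {(u, v). R \<inter> (univ (A u) \<times> univ (A v)) \<noteq> {}}"

definition C_rel :: "('i::semilattice_sup \<Rightarrow> ('f, 'a) alg) \<Rightarrow> 'a rel \<Rightarrow> 'i rel" where
  "C_rel A \<theta> = {(i, j). (i, sup i j) \<in> S_rel A \<theta> \<and> (j, sup i j) \<in> S_rel A \<theta>}"

definition Psi ::
  "('f \<Rightarrow> nat) \<Rightarrow> ('i::semilattice_sup \<Rightarrow> ('f, 'a) alg) \<Rightarrow> ('i \<Rightarrow> 'i \<Rightarrow> 'a \<Rightarrow> 'a) \<Rightarrow> 'a rel \<Rightarrow> 'i \<Rightarrow> 'a rel" where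
  "Psi ar A p R i = gen_con ar (A i)
     (\<Union>u\<in>{..i}. \<Union>v\<in>{..i}. map_prod (p u i) (p v i) ` (R \<inter> (univ (A u) \<times> univ (A v))))"

definition theta_fam ::
  "('f \<Rightarrow> nat) \<Rightarrow> ('i::semilattice_sup \<Rightarrow> ('f, 'a) alg) \<Rightarrow> ('i \<Rightarrow> 'i \<Rightarrow> 'a \<Rightarrow> 'a) \<Rightarrow>
    'i rel \<Rightarrow> 'a rel \<Rightarrow> 'i \<Rightarrow> 'a rel" where
  "theta_fam ar A p C R i = {(a, b). a \<in> univ (A i) \<and> b \<in> univ (A i) \<and>
     (\<exists>k. i \<le> k \<and> (i, k) \<in> S_fam A p C (Psi ar A p R) \<and> (p i k a, p i k b) \<in> Psi ar A p R k)}"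

end

theory Submission
  imports Defs
begin

text \<open>The sets \<open>\<Psi>\<^sub>i\<close> form a family of congruences preserved by the maps \<open>p\<^sub>i\<^sub>j\<close>, and \<open>\<theta>\<^sub>i\<^sub>i\<close> is the
  union of the preimages of the \<open>\<Psi>\<^sub>k\<close> over all \<open>k \<ge> i\<close> that are \<open>C\<close>-related to \<open>i\<close>: the condition
  \<open>(i, k) \<in> S\<^sub>C\<^sup>\<Psi>\<close> reduces to \<open>(i, k) \<in> C\<close> for comparable indices, since \<open>(a, p\<^sub>i\<^sub>k a)\<close> always witnesses
  nonemptiness. As \<open>C\<close> is a congruence of \<open>\<^bold>I\<close> these \<open>k\<close> are directed, so the union is a congruence.
  Conditions (iii) and (iv) hold because \<open>k\<close> may be enlarged within its \<open>C\<close>-class.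
  The last claim is the case \<open>R = \<emptyset>\<close>.\<close>

section \<open>Congruences of algebras\<close>

lemma ConI:
  assumes "equiv (univ M) \<theta>"
    and "\<And>f as bs. length as = ar f \<Longrightarrow> length bs = ar f \<Longrightarrow>
      list_all2 (\<lambda>a b. (a, b) \<in> \<theta>) as bs \<Longrightarrow> (oper M f as, oper M f bs) \<in> \<theta>"
  shows "\<theta> \<in> Con ar M"
  using assms unfolding Con_def by blast

lemma Con_equiv: "\<theta> \<in> Con ar M \<Longrightarrow> equiv (univ M) \<theta>"
  unfolding Con_def by blast

lemma Con_oper:
  assumes "\<theta> \<in> Con ar M" "length as = ar f" "list_all2 (\<lambda>a b. (a, b) \<in> \<theta>) as bs"
  shows "(oper M f as, oper M f bs) \<in> \<theta>"
  using assms list_all2_lengthD[OF assms(3)] unfolding Con_def by auto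

lemma Con_carrier: "\<theta> \<in> Con ar M \<Longrightarrow> (a, b) \<in> \<theta> \<Longrightarrow> a \<in> univ M \<and> b \<in> univ M"
  using Con_equiv equiv_type by fastforce

lemma Con_refl: "\<theta> \<in> Con ar M \<Longrightarrow> a \<in> univ M \<Longrightarrow> (a, a) \<in> \<theta>"
  using Con_equiv equiv_class_self by fastforce

lemma Con_sym: "\<theta> \<in> Con ar M \<Longrightarrow> (a, b) \<in> \<theta> \<Longrightarrow> (b, a) \<in> \<theta>"
  using Con_equiv by (metis equivE symD)

lemma Con_trans: "\<theta> \<in> Con ar M \<Longrightarrow> (a, b) \<in> \<theta> \<Longrightarrow> (b, c) \<in> \<theta> \<Longrightarrow> (a, c) \<in> \<theta>"
  using Con_equiv by (metis equivE transD)

lemma equivI_pointwise: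
  assumes "\<And>a b. (a, b) \<in> r \<Longrightarrow> a \<in> S \<and> b \<in> S"
    and "\<And>a. a \<in> S \<Longrightarrow> (a, a) \<in> r"
    and "\<And>a b. (a, b) \<in> r \<Longrightarrow> (b, a) \<in> r"
    and "\<And>a b c. (a, b) \<in> r \<Longrightarrow> (b, c) \<in> r \<Longrightarrow> (a, c) \<in> r"
  shows "equiv S r"
proof (rule equivI)
  show "r \<subseteq> S \<times> S"
    using assms(1) by auto
  show "refl_on S r"
    by (rule refl_onI) (rule assms(2))
  show "sym r"
    by (rule symI) (rule assms(3))
  show "trans r"
    by (rule transI) (rule assms(4))
qed

lemma list_all2_carrier:
  assumes "list_all2 (\<lambda>a b. (a, b) \<in> r) as bs" "r \<subseteq> S \<times> S"
  shows "set as \<subseteq> S" "set bs \<subseteq> S"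
  using assms by (induction rule: list_all2_induct) auto

text \<open>The full relation is a member of the family intersected in \<open>gen_con\<close>, so
  that intersection is not the degenerate \<open>\<Inter>{} = UNIV\<close>.\<close>

lemma Times_in_Con:
  assumes "algebra ar M"
  shows "univ M \<times> univ M \<in> Con ar M"
proof (rule ConI)
  show "equiv (univ M) (univ M \<times> univ M)"
    by (rule equivI_pointwise) auto
next
  fix f as bs
  assume "length as = ar f" "length bs = ar f"
    and "list_all2 (\<lambda>a b. (a, b) \<in> univ M \<times> univ M) as bs"
  then show "(oper M f as, oper M f bs) \<in> univ M \<times> univ M"
    using assms list_all2_carrier[OF _ order_refl] unfolding algebra_def by blast
qed

lemma Inter_in_Con:
  assumes "F \<noteq> {}" "F \<subseteq> Con ar M"
  shows "\<Inter>F \<in> Con ar M"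
proof (rule ConI)
  have mem: "\<theta> \<in> Con ar M" if "\<theta> \<in> F" for \<theta>
    using assms that by blast
  \<comment> \<open>One fixed member confines the intersection to the universe.\<close>
  obtain \<theta>\<^sub>0 where "\<theta>\<^sub>0 \<in> F"
    using assms by blast
  show "equiv (univ M) (\<Inter>F)"
  proof (rule equivI_pointwise)
    show "a \<in> univ M \<and> b \<in> univ M" if "(a, b) \<in> \<Inter>F" for a b
      using that Con_carrier[OF mem[OF \<open>\<theta>\<^sub>0 \<in> F\<close>]] \<open>\<theta>\<^sub>0 \<in> F\<close> by blast
    show "(a, a) \<in> \<Inter>F" if "a \<in> univ M" for a
      using that Con_refl[OF mem] by blast
    show "(b, a) \<in> \<Inter>F" if "(a, b) \<in> \<Inter>F" for a b
      using that Con_sym[OF mem] by blast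
    show "(a, c) \<in> \<Inter>F" if "(a, b) \<in> \<Inter>F" "(b, c) \<in> \<Inter>F" for a b c
      using that Con_trans[OF mem] by blast
  qed
  fix f as bs
  assume len: "length as = ar f" and rel: "list_all2 (\<lambda>a b. (a, b) \<in> \<Inter>F) as bs"
  have "(oper M f as, oper M f bs) \<in> \<theta>" if "\<theta> \<in> F" for \<theta>
  proof (rule Con_oper[OF mem[OF that] len])
    show "list_all2 (\<lambda>a b. (a, b) \<in> \<theta>) as bs"
      using rel by (rule list_all2_mono) (use that in blast)
  qed
  then show "(oper M f as, oper M f bs) \<in> \<Inter>F"
    by blast
qed

text \<open>Operations are finitary: induction along the argument lists collects the finitely many
  members involved into a single one, and compatibility is applied there. Transitivity uses the same
  merging for two pairs.\<close>

lemma Union_directed_in_Con: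
  assumes "F \<noteq> {}" "F \<subseteq> Con ar M"
    and dir: "\<And>X Y. X \<in> F \<Longrightarrow> Y \<in> F \<Longrightarrow> \<exists>Z\<in>F. X \<union> Y \<subseteq> Z"
  shows "\<Union>F \<in> Con ar M"
proof (rule ConI)
  have mem: "\<theta> \<in> Con ar M" if "\<theta> \<in> F" for \<theta>
    using assms that by blast
  show "equiv (univ M) (\<Union>F)"
  proof (rule equivI_pointwise)
    show "a \<in> univ M \<and> b \<in> univ M" if "(a, b) \<in> \<Union>F" for a b
      using that Con_carrier[OF mem] by blast
    show "(a, a) \<in> \<Union>F" if "a \<in> univ M" for a
      using that Con_refl[OF mem] \<open>F \<noteq> {}\<close> by blast
    show "(b, a) \<in> \<Union>F" if "(a, b) \<in> \<Union>F" for a b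
      using that Con_sym[OF mem] by blast
    fix a b c
    assume "(a, b) \<in> \<Union>F" "(b, c) \<in> \<Union>F"
    then obtain X Y where XY: "X \<in> F" "(a, b) \<in> X" "Y \<in> F" "(b, c) \<in> Y"
      by blast
    then obtain Z where "Z \<in> F" "X \<union> Y \<subseteq> Z"
      using dir by blast
    then show "(a, c) \<in> \<Union>F"
      using Con_trans[OF mem[of Z], of a b c] XY by blast
  qed
  fix f as bs
  assume len: "length as = ar f" and rel: "list_all2 (\<lambda>a b. (a, b) \<in> \<Union>F) as bs"
  from rel have "\<exists>Z\<in>F. list_all2 (\<lambda>a b. (a, b) \<in> Z) as bs"
  proof (induction rule: list_all2_induct)
    case Nil
    then show ?case
      using \<open>F \<noteq> {}\<close> by auto
  next
    case (Cons a as b bs)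
    then obtain X Y where X: "X \<in> F" "(a, b) \<in> X"
      and Y: "Y \<in> F" "list_all2 (\<lambda>a b. (a, b) \<in> Y) as bs"
      by blast
    then obtain Z where "Z \<in> F" "X \<union> Y \<subseteq> Z"
      using dir by blast
    then have "list_all2 (\<lambda>a b. (a, b) \<in> Z) (a # as) (b # bs)"
      using X list_all2_mono[OF Y(2), of "\<lambda>a b. (a, b) \<in> Z"] by auto
    then show ?case
      using \<open>Z \<in> F\<close> by blast
  qed
  then show "(oper M f as, oper M f bs) \<in> \<Union>F"
    using Con_oper[OF mem len] by blast
qed

text \<open>The homomorphism law moves \<open>h\<close> inside the operation, where compatibility of
  \<theta> applies; closure of \<open>M\<close> keeps the values in the universe.\<close>

lemma vimage_in_Con:
  assumes "algebra ar M" "alg_hom ar M N h" "\<theta> \<in> Con ar N"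
  shows "{(a, b). a \<in> univ M \<and> b \<in> univ M \<and> (h a, h b) \<in> \<theta>} \<in> Con ar M" (is "?P \<in> _")
proof (rule ConI)
  have h: "h a \<in> univ N" if "a \<in> univ M" for a
    using assms(2) that unfolding alg_hom_def by blast
  show "equiv (univ M) ?P"
    by (rule equivI_pointwise)
      (use h Con_refl[OF assms(3)] Con_sym[OF assms(3)] Con_trans[OF assms(3)] in blast)+
  fix f as bs
  assume len: "length as = ar f" "length bs = ar f"
    and rel: "list_all2 (\<lambda>a b. (a, b) \<in> ?P) as bs"
  have sub: "set as \<subseteq> univ M" "set bs \<subseteq> univ M"
    using list_all2_carrier[OF rel] by blast+
  have "list_all2 (\<lambda>a b. (a, b) \<in> \<theta>) (map h as) (map h bs)"
    using rel by (auto simp: list_all2_map1 list_all2_map2 elim: list_all2_mono)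
  then have "(oper N f (map h as), oper N f (map h bs)) \<in> \<theta>"
    using Con_oper[OF assms(3)] len by simp
  moreover have "h (oper M f as) = oper N f (map h as)" "h (oper M f bs) = oper N f (map h bs)"
    using assms(2) len sub unfolding alg_hom_def by auto
  moreover have "oper M f as \<in> univ M" "oper M f bs \<in> univ M"
    using assms(1) len sub unfolding algebra_def by auto
  ultimately show "(oper M f as, oper M f bs) \<in> ?P"
    by simp
qed

section \<open>Generated congruences\<close>

lemma gen_con_in_Con:
  assumes "algebra ar M" "X \<subseteq> univ M \<times> univ M"
  shows "gen_con ar M X \<in> Con ar M"
  unfolding gen_con_def using Times_in_Con[OF assms(1)] assms(2) by (intro Inter_in_Con) blast+

lemma gen_con_superset: "X \<subseteq> gen_con ar M X"
  unfolding gen_con_def by blast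

lemma gen_con_least: "\<theta> \<in> Con ar M \<Longrightarrow> X \<subseteq> \<theta> \<Longrightarrow> gen_con ar M X \<subseteq> \<theta>"
  unfolding gen_con_def by blast

section \<open>Congruences of semilattices\<close>

lemma semilattice_Con_refl: "C \<in> semilattice_Con \<Longrightarrow> (i, i) \<in> C"
  unfolding semilattice_Con_def by (auto simp: equiv_def refl_on_def)

lemma semilattice_Con_sym: "C \<in> semilattice_Con \<Longrightarrow> (i, j) \<in> C \<Longrightarrow> (j, i) \<in> C"
  unfolding semilattice_Con_def by (auto simp: equiv_def dest: symD)

lemma semilattice_Con_trans:
  "C \<in> semilattice_Con \<Longrightarrow> (i, j) \<in> C \<Longrightarrow> (j, k) \<in> C \<Longrightarrow> (i, k) \<in> C"
  unfolding semilattice_Con_def by (auto simp: equiv_def dest: transD)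

lemma semilattice_Con_sup:
  "C \<in> semilattice_Con \<Longrightarrow> (i, j) \<in> C \<Longrightarrow> (k, l) \<in> C \<Longrightarrow> (sup i k, sup j l) \<in> C"
  unfolding semilattice_Con_def by blast

text \<open>Join the pair with the reflexive pair \<open>(i, i)\<close>. Classes are thus closed
  under joins, which are the indices where elements get compared.\<close>

lemma semilattice_Con_sup_left: "C \<in> semilattice_Con \<Longrightarrow> (i, j) \<in> C \<Longrightarrow> (i, sup i j) \<in> C"
  using semilattice_Con_sup[of C i i i j] semilattice_Con_refl[of C i] by simp

lemma semilattice_Con_sup_right: "C \<in> semilattice_Con \<Longrightarrow> (i, j) \<in> C \<Longrightarrow> (j, sup i j) \<in> C"
  using semilattice_Con_sup_left semilattice_Con_sym semilattice_Con_trans by blast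

text \<open>Iterates binary compatibility. The value of an operation in the sum lives at the join of
  the argument indices, so this relates the indices of two values. \<open>Sup_fin\<close> is
  meaningful only on nonempty sets.\<close>

lemma semilattice_Con_Sup_fin:
  assumes "C \<in> semilattice_Con" "list_all2 (\<lambda>i j. (i, j) \<in> C) is js" "is \<noteq> []"
  shows "(Sup_fin (set is), Sup_fin (set js)) \<in> C"
  using assms(2,3)
proof (induction rule: list_all2_induct)
  case (Cons i ks j ls)
  show ?case
  proof (cases "ks = []")
    case True
    then show ?thesis
      using Cons by simp
  next
    case False
    moreover from this have "ls \<noteq> []"
      using Cons by auto
    ultimately show ?thesis
      using Cons semilattice_Con_sup[OF assms(1)] by simp
  qed
qed simp

section \<open>Direct systems and their congruences\<close>

locale semilattice_system =
  fixes ar :: "'f \<Rightarrow> nat"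
    and A :: "'i::semilattice_sup \<Rightarrow> ('f, 'a) alg"
    and p :: "'i \<Rightarrow> 'i \<Rightarrow> 'a \<Rightarrow> 'a"
  assumes system: "direct_system ar A p"
begin

lemma algebra_A: "algebra ar (A i)"
  using system by (simp add: direct_system_def)

lemma univ_A_nonempty: "univ (A i) \<noteq> {}"
  using algebra_A unfolding algebra_def by blast

lemma hom_p: "i \<le> j \<Longrightarrow> alg_hom ar (A i) (A j) (p i j)"
  using system by (simp add: direct_system_def)

lemma p_closed: "i \<le> j \<Longrightarrow> a \<in> univ (A i) \<Longrightarrow> p i j a \<in> univ (A j)"
  using hom_p unfolding alg_hom_def by blast

lemma p_oper:
  "i \<le> j \<Longrightarrow> length as = ar f \<Longrightarrow> set as \<subseteq> univ (A i) \<Longrightarrow>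
    p i j (oper (A i) f as) = oper (A j) f (map (p i j) as)"
  using hom_p unfolding alg_hom_def by blast

lemma p_id: "a \<in> univ (A i) \<Longrightarrow> p i i a = a"
  using system by (simp add: direct_system_def)

lemma p_comp:
  assumes "i \<le> j" "j \<le> k" "a \<in> univ (A i)"
  shows "p j k (p i j a) = p i k a"
proof -
  have "\<forall>i j k. i \<le> j \<longrightarrow> j \<le> k \<longrightarrow> (\<forall>a\<in>univ (A i). p i k a = p j k (p i j a))"
    using system unfolding direct_system_def by (elim conjE)
  from this[rule_format, OF assms] show ?thesis
    by (rule sym)
qed

lemma index_unique:
  assumes "a \<in> univ (A i)" "a \<in> univ (A j)"
  shows "i = j"
proof -
  have "\<forall>i j. i \<noteq> j \<longrightarrow> univ (A i) \<inter> univ (A j) = {}"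
    using system unfolding direct_system_def by (elim conjE)
  then show ?thesis
    using assms by blast
qed

text \<open>Disjointness of the components makes the definite description well defined.\<close>

lemma index_of_eq: "a \<in> univ (A i) \<Longrightarrow> index_of A a = i"
  unfolding index_of_def using index_unique by blast

section \<open>Operations of the Plonka sum\<close>

lemma univ_plonka_sum: "univ (plonka_sum A p) = (\<Union>i. univ (A i))"
  unfolding plonka_sum_def by simp

lemma oper_plonka_sum:
  assumes "as \<noteq> []"
  shows "oper (plonka_sum A p) f as = oper (A (Sup_fin (index_of A ` set as))) f
    (map (\<lambda>a. p (index_of A a) (Sup_fin (index_of A ` set as)) a) as)"
  using assms unfolding plonka_sum_def by (simp add: Let_def)

lemma oper_plonka_sum_Nil:
  assumes "ar f = 0"
  obtains i where "oper (plonka_sum A p) f [] \<in> univ (A i)"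
proof
  show "oper (plonka_sum A p) f [] \<in> univ (A (THE i\<^sub>0. \<forall>i. i\<^sub>0 \<le> i))"
    using algebra_A assms unfolding plonka_sum_def algebra_def by simp
qed

lemma index_le_Sup_fin: "a \<in> set as \<Longrightarrow> index_of A a \<le> Sup_fin (index_of A ` set as)"
  by (simp add: Sup_fin.coboundedI)

text \<open>Since the maps are homomorphisms and compose, pushing a value up to \<open>k\<close>
  amounts to moving every argument straight to \<open>k\<close>. Two values with different indices
  can then be compared in one algebra.\<close>

lemma p_oper_plonka_sum:
  assumes "as \<noteq> []" "length as = ar f" "set as \<subseteq> univ (plonka_sum A p)"
    and k: "Sup_fin (index_of A ` set as) \<le> k"
  shows "oper (plonka_sum A p) f as \<in> univ (A (Sup_fin (index_of A ` set as)))"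
    and "p (Sup_fin (index_of A ` set as)) k (oper (plonka_sum A p) f as) =
      oper (A k) f (map (\<lambda>a. p (index_of A a) k a) as)"
proof -
  let ?i = "Sup_fin (index_of A ` set as)"
  let ?as = "map (\<lambda>a. p (index_of A a) ?i a) as"
  have a: "a \<in> univ (A (index_of A a))" if "a \<in> set as" for a
    using that assms(3) index_of_eq unfolding univ_plonka_sum by blast
  have sub: "set ?as \<subseteq> univ (A ?i)"
    using a p_closed[OF index_le_Sup_fin] by auto
  then show "oper (plonka_sum A p) f as \<in> univ (A ?i)"
    using algebra_A assms(2) unfolding algebra_def oper_plonka_sum[OF assms(1)] by simp
  have "map (p ?i k) ?as = map (\<lambda>a. p (index_of A a) k a) as"
    using p_comp[OF index_le_Sup_fin k] a by simp
  then show "p ?i k (oper (plonka_sum A p) f as) = oper (A k) f (map (\<lambda>a. p (index_of A a) k a) as)"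
    using p_oper[OF k _ sub, of f] assms(2) unfolding oper_plonka_sum[OF assms(1)] by (simp del: map_map)
qed

text \<open>Components are nonempty, and any \<open>a\<close> paired with its image
  \<open>p i k a\<close> is sent to a diagonal pair of \<open>\<theta> k\<close>.\<close>

lemma S_fam_comparable:
  assumes "i \<le> k" "\<theta> k \<in> Con ar (A k)"
  shows "(i, k) \<in> S_fam A p C \<theta> \<longleftrightarrow> (i, k) \<in> C"
proof -
  obtain a where a: "a \<in> univ (A i)"
    using univ_A_nonempty by blast
  have "(a, p i k a) \<in> pull A p i k (\<theta> (sup i k))"
    unfolding pull_def using assms(1) a p_closed p_id Con_refl[OF assms(2)]
    by (simp add: sup_absorb2)
  then show ?thesis
    unfolding S_fam_def by blast
qed

text \<open>Disjointness lets \<open>a\<close> and \<open>b\<close> determine their indices, and the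
  pair itself witnesses the nonemptiness demanded by \<open>S_fam\<close>.\<close>

lemma assoc_congruence_iff:
  assumes "a \<in> univ (A i)" "b \<in> univ (A j)"
  shows "(a, b) \<in> assoc_congruence A p C \<theta> \<longleftrightarrow>
    (i, j) \<in> C \<and> (p i (sup i j) a, p j (sup i j) b) \<in> \<theta> (sup i j)"
  using assms index_unique unfolding assoc_congruence_def S_fam_def pull_def by blast

lemma assoc_congruenceE:
  assumes "(a, b) \<in> assoc_congruence A p C \<theta>"
  obtains i j where "a \<in> univ (A i)" "b \<in> univ (A j)" "(i, j) \<in> C"
    "(p i (sup i j) a, p j (sup i j) b) \<in> \<theta> (sup i j)"
  using assms unfolding assoc_congruence_def pull_def S_fam_def by blast

section \<open>The associated congruence of a system congruence\<close>

context
  fixes C :: "'i rel" and \<theta> :: "'i \<Rightarrow> 'a rel"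
  assumes sc: "system_congruence ar A p C \<theta>"
begin

lemma system_C: "C \<in> semilattice_Con"
  using sc unfolding system_congruence_def by blast

lemma system_Con: "\<theta> i \<in> Con ar (A i)"
  using sc unfolding system_congruence_def by blast

lemma system_push:
  assumes "i \<le> k" "(a, b) \<in> \<theta> i"
  shows "(p i k a, p i k b) \<in> \<theta> k"
proof -
  have "\<theta> i \<subseteq> {(a, b). a \<in> univ (A i) \<and> b \<in> univ (A i) \<and>
      (p i (sup i k) a, p i (sup i k) b) \<in> \<theta> (sup i k)}"
    using sc unfolding system_congruence_def by blast
  then show ?thesis
    using assms by (auto simp: sup_absorb2)
qed

text \<open>Condition (iv) at comparable indices: the join is \<open>k\<close>, and membership in
  \<open>S_fam\<close> reduces to \<open>(i, k) \<in> C\<close>.\<close>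

lemma system_pull:
  assumes "i \<le> k" "(i, k) \<in> C" "a \<in> univ (A i)" "b \<in> univ (A i)" "(p i k a, p i k b) \<in> \<theta> k"
  shows "(a, b) \<in> \<theta> i"
proof -
  have "(i, k) \<in> S_fam A p C \<theta>"
    using assms S_fam_comparable[of i k \<theta>, OF assms(1) system_Con] by blast
  then have "\<theta> i = {(a, b). a \<in> univ (A i) \<and> b \<in> univ (A i) \<and>
      (p i (sup i k) a, p i (sup i k) b) \<in> \<theta> (sup i k)}"
    using sc unfolding system_congruence_def by blast
  then show ?thesis
    using assms by (simp add: sup_absorb2)
qed

text \<open>Condition (iv) lets one test at any common upper bound in the right \<open>C\<close>-class; three elements
  can then be compared at a single index, which gives transitivity.\<close>

lemma assoc_congruence_iff_bound:
  assumes "a \<in> univ (A i)" "b \<in> univ (A j)" "i \<le> k" "j \<le> k" "(i, k) \<in> C"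
  shows "(a, b) \<in> assoc_congruence A p C \<theta> \<longleftrightarrow> (i, j) \<in> C \<and> (p i k a, p j k b) \<in> \<theta> k"
proof (cases "(i, j) \<in> C")
  case True
  let ?s = "sup i j"
  have le: "i \<le> ?s" "j \<le> ?s" "?s \<le> k"
    using assms by auto
  \<comment> \<open>\<open>i\<close> is related to both \<open>?s\<close> and \<open>k\<close>.
    Hence pairs can be pulled back from \<open>k\<close> to \<open>?s\<close>, not only pushed
    up.\<close>
  have "(?s, k) \<in> C"
    using semilattice_Con_sup_left[OF system_C True] assms(5) system_C
      semilattice_Con_sym semilattice_Con_trans by blast
  moreover have "p ?s k (p i ?s a) = p i k a" "p ?s k (p j ?s b) = p j k b"
    using p_comp le assms by auto
  moreover have "p i ?s a \<in> univ (A ?s)" "p j ?s b \<in> univ (A ?s)"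
    using p_closed le assms by auto
  ultimately have "(p i ?s a, p j ?s b) \<in> \<theta> ?s \<longleftrightarrow> (p i k a, p j k b) \<in> \<theta> k"
    using system_push[OF le(3)] system_pull[OF le(3)] by metis
  then show ?thesis
    unfolding assoc_congruence_iff[OF assms(1,2)] by blast
qed (simp add: assoc_congruence_iff[OF assms(1,2)])

lemma assoc_congruence_equiv: "equiv (univ (plonka_sum A p)) (assoc_congruence A p C \<theta>)"
proof (rule equivI_pointwise)
  show "a \<in> univ (plonka_sum A p) \<and> b \<in> univ (plonka_sum A p)"
    if "(a, b) \<in> assoc_congruence A p C \<theta>" for a b
    using that unfolding univ_plonka_sum by (auto elim: assoc_congruenceE)
  show "(a, a) \<in> assoc_congruence A p C \<theta>" if a: "a \<in> univ (plonka_sum A p)" for a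
  proof -
    obtain i where "a \<in> univ (A i)"
      using a unfolding univ_plonka_sum by blast
    then show ?thesis
      using assoc_congruence_iff semilattice_Con_refl[OF system_C] Con_refl[OF system_Con]
      by (simp add: p_id)
  qed
  show "(b, a) \<in> assoc_congruence A p C \<theta>" if "(a, b) \<in> assoc_congruence A p C \<theta>" for a b
    using that
  proof (rule assoc_congruenceE)
    fix i j
    assume "a \<in> univ (A i)" "b \<in> univ (A j)" "(i, j) \<in> C"
      "(p i (sup i j) a, p j (sup i j) b) \<in> \<theta> (sup i j)"
    then show ?thesis
      using assoc_congruence_iff semilattice_Con_sym[OF system_C] Con_sym[OF system_Con]
      by (simp add: sup_commute)
  qed
  fix a b c
  assume ab: "(a, b) \<in> assoc_congruence A p C \<theta>" and bc: "(b, c) \<in> assoc_congruence A p C \<theta>"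
  obtain i j where a: "a \<in> univ (A i)" and b: "b \<in> univ (A j)" and ij: "(i, j) \<in> C"
    using ab by (rule assoc_congruenceE)
  obtain j' k where b': "b \<in> univ (A j')" and c: "c \<in> univ (A k)" and j'k: "(j', k) \<in> C"
    using bc by (rule assoc_congruenceE)
  \<comment> \<open>The middle element lies in only one component, so the two indices found for it
    agree.\<close>
  have jk: "(j, k) \<in> C"
    using j'k index_unique[OF b b'] by simp
  have ik: "(i, k) \<in> C"
    using semilattice_Con_trans[OF system_C ij jk] .
  let ?s = "sup i (sup j k)"
  have le: "i \<le> ?s" "j \<le> ?s" "k \<le> ?s"
    by (auto intro: le_supI2)
  \<comment> \<open>Joining \<open>(j, i)\<close> with \<open>(j, sup j k)\<close> keeps the
    threefold join in the class of \<open>j\<close>.\<close>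
  have js: "(j, ?s) \<in> C"
    using semilattice_Con_sup[OF system_C semilattice_Con_sym[OF system_C ij]
        semilattice_Con_sup_left[OF system_C jk]] by (simp add: sup_left_commute sup_assoc)
  then have "(i, ?s) \<in> C"
    using semilattice_Con_trans[OF system_C ij] by blast
  then show "(a, c) \<in> assoc_congruence A p C \<theta>"
    using ab bc ik js assoc_congruence_iff_bound a b c le Con_trans[OF system_Con] by meson
qed

text \<open>Both values are pushed to the join of their indices. There they become values of the
  operation of one algebra \<open>A ?k\<close> on arguments related by \<open>\<theta> ?k\<close>,
  which is a congruence.\<close>

lemma assoc_congruence_in_Con: "assoc_congruence A p C \<theta> \<in> Con ar (plonka_sum A p)" (is "?\<Theta> \<in> _")
proof (rule ConI)
  show "equiv (univ (plonka_sum A p)) ?\<Theta>"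
    by (rule assoc_congruence_equiv)
  fix f as bs
  assume len: "length as = ar f" "length bs = ar f" and rel: "list_all2 (\<lambda>a b. (a, b) \<in> ?\<Theta>) as bs"
  show "(oper (plonka_sum A p) f as, oper (plonka_sum A p) f bs) \<in> ?\<Theta>"
  proof (cases "as = []")
    \<comment> \<open>For a constant both sides coincide, so reflexivity suffices once the value is
      known to lie in some component.\<close>
    case True
    then obtain i where "oper (plonka_sum A p) f [] \<in> univ (A i)"
      using len oper_plonka_sum_Nil by auto
    then show ?thesis
      using True rel assoc_congruence_equiv unfolding equiv_def refl_on_def univ_plonka_sum by auto
  next
    case False
    then have ne: "as \<noteq> []" "bs \<noteq> []"
      using rel by auto
    have sub: "set as \<subseteq> univ (plonka_sum A p)" "set bs \<subseteq> univ (plonka_sum A p)"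
      using list_all2_carrier[OF rel equiv_type[OF assoc_congruence_equiv]] by auto
    let ?i = "Sup_fin (index_of A ` set as)" and ?j = "Sup_fin (index_of A ` set bs)"
    let ?k = "sup ?i ?j"
    \<comment> \<open>Related arguments have \<open>C\<close>-related indices, hence so do the joins
      \<open>?i\<close> and \<open>?j\<close>.\<close>
    have "list_all2 (\<lambda>i j. (i, j) \<in> C) (map (index_of A) as) (map (index_of A) bs)"
      using rel unfolding list_all2_map1 list_all2_map2
      by (rule list_all2_mono) (auto elim!: assoc_congruenceE simp: index_of_eq)
    from semilattice_Con_Sup_fin[OF system_C this] have C: "(?i, ?j) \<in> C"
      using ne by simp
    have "list_all2 (\<lambda>a b. (a, b) \<in> \<theta> ?k)
      (map (\<lambda>a. p (index_of A a) ?k a) as) (map (\<lambda>b. p (index_of A b) ?k b) bs)"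
      unfolding list_all2_map1 list_all2_map2
    proof (rule list.rel_mono_strong[OF rel])
      fix a b
      assume "a \<in> set as" "b \<in> set bs" "(a, b) \<in> ?\<Theta>"
      from this(3) obtain i j where ab: "a \<in> univ (A i)" "b \<in> univ (A j)"
        "(p i (sup i j) a, p j (sup i j) b) \<in> \<theta> (sup i j)"
        by (rule assoc_congruenceE)
      \<comment> \<open>The arguments are related at \<open>sup i j\<close>, which lies below
        \<open>?k\<close>; condition (iii) carries the pair upwards.\<close>
      have le: "i \<le> ?k" "j \<le> ?k"
        using index_le_Sup_fin[OF \<open>a \<in> set as\<close>] index_le_Sup_fin[OF \<open>b \<in> set bs\<close>] ab
        by (auto simp: index_of_eq intro: le_supI1 le_supI2)
      then have "sup i j \<le> ?k"
        by simp
      from system_push[OF this ab(3)] show "(p (index_of A a) ?k a, p (index_of A b) ?k b) \<in> \<theta> ?k"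
        using p_comp[OF sup_ge1 \<open>sup i j \<le> ?k\<close> ab(1)] p_comp[OF sup_ge2 \<open>sup i j \<le> ?k\<close> ab(2)] ab
        by (simp add: index_of_eq)
    qed
    then have "(p ?i ?k (oper (plonka_sum A p) f as), p ?j ?k (oper (plonka_sum A p) f bs)) \<in> \<theta> ?k"
      using p_oper_plonka_sum(2)[OF ne(1) len(1) sub(1) sup_ge1]
        p_oper_plonka_sum(2)[OF ne(2) len(2) sub(2) sup_ge2] Con_oper[OF system_Con] len by simp
    then show ?thesis
      using assoc_congruence_iff p_oper_plonka_sum(1)[OF ne(1) len(1) sub(1) order_refl]
        p_oper_plonka_sum(1)[OF ne(2) len(2) sub(2) order_refl] C by blast
  qed
qed

text \<open>\<open>C_rel\<close> tests only the comparable pairs of \<open>i\<close> and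
  \<open>j\<close> with their join. On comparable indices \<open>S_rel\<close> agrees with
  \<open>C\<close>, through the pairs \<open>(a, p i k a)\<close>, and two indices are
  \<open>C\<close>-related exactly when both are related to their join.\<close>

lemma C_rel_assoc_congruence: "C_rel A (assoc_congruence A p C \<theta>) = C"
proof -
  have S: "(i, k) \<in> S_rel A (assoc_congruence A p C \<theta>) \<longleftrightarrow> (i, k) \<in> C" if "i \<le> k" for i k
  proof
    assume "(i, k) \<in> S_rel A (assoc_congruence A p C \<theta>)"
    then show "(i, k) \<in> C"
      unfolding S_rel_def using assoc_congruence_iff by blast
  next
    assume ik: "(i, k) \<in> C"
    obtain a where a: "a \<in> univ (A i)"
      using univ_A_nonempty by blast
    have "(a, p i k a) \<in> assoc_congruence A p C \<theta>"
      using that ik a p_closed p_id Con_refl[OF system_Con]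
      by (simp add: assoc_congruence_iff[of _ i _ k] sup_absorb2)
    then show "(i, k) \<in> S_rel A (assoc_congruence A p C \<theta>)"
      unfolding S_rel_def using a p_closed[OF that] by blast
  qed
  have "(i, sup i j) \<in> C \<and> (j, sup i j) \<in> C \<longleftrightarrow> (i, j) \<in> C" for i j
    using semilattice_Con_sup_left semilattice_Con_sup_right semilattice_Con_sym
      semilattice_Con_trans system_C by metis
  then show ?thesis
    unfolding C_rel_def by (auto simp: S)
qed

end

section \<open>The congruence generated by a relation\<close>

lemma Psi_in_Con: "Psi ar A p R i \<in> Con ar (A i)"
  unfolding Psi_def by (rule gen_con_in_Con[OF algebra_A]) (auto intro: p_closed)

lemma Psi_base:
  assumes "(a, b) \<in> R" "a \<in> univ (A u)" "b \<in> univ (A v)" "u \<le> i" "v \<le> i"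
  shows "(p u i a, p v i b) \<in> Psi ar A p R i"
proof -
  have "(p u i a, p v i b) \<in> map_prod (p u i) (p v i) ` (R \<inter> (univ (A u) \<times> univ (A v)))"
    using assms by force
  then show ?thesis
    unfolding Psi_def using assms(4,5) by (intro subsetD[OF gen_con_superset] UN_I) simp_all
qed

text \<open>By minimality of the generated congruence: the preimage of \<Psi> at \<open>k\<close> is
  a congruence of \<open>A i\<close>, and it contains the generators at \<open>i\<close> because
  they are sent to generators at \<open>k\<close>.\<close>

lemma Psi_push:
  assumes "i \<le> k" "(a, b) \<in> Psi ar A p R i"
  shows "(p i k a, p i k b) \<in> Psi ar A p R k"
proof -
  have "Psi ar A p R i \<subseteq>
    {(a, b). a \<in> univ (A i) \<and> b \<in> univ (A i) \<and> (p i k a, p i k b) \<in> Psi ar A p R k}"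
    unfolding Psi_def[of ar A p R i]
  proof (rule gen_con_least[OF vimage_in_Con[OF algebra_A hom_p[OF assms(1)] Psi_in_Con]], safe)
    fix u v a b
    assume uv: "u \<le> i" "v \<le> i" and ab: "(a, b) \<in> R" "a \<in> univ (A u)" "b \<in> univ (A v)"
    show "p u i a \<in> univ (A i)" "p v i b \<in> univ (A i)"
      using p_closed uv ab by auto
    show "(p i k (p u i a), p i k (p v i b)) \<in> Psi ar A p R k"
      using Psi_base[OF ab order_trans[OF uv(1) assms(1)] order_trans[OF uv(2) assms(1)]]
        p_comp uv ab assms(1) by simp
  qed
  then show ?thesis
    using assms(2) by blast
qed

section \<open>The family \<theta> obtained from \<Psi> along the classes of
  \<open>C\<close>\<close>

lemma theta_fam_iff:
  "(a, b) \<in> theta_fam ar A p C R i \<longleftrightarrow> a \<in> univ (A i) \<and> b \<in> univ (A i) \<and>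
    (\<exists>k. i \<le> k \<and> (i, k) \<in> C \<and> (p i k a, p i k b) \<in> Psi ar A p R k)"
  unfolding theta_fam_def using S_fam_comparable[where \<theta> = "Psi ar A p R", OF _ Psi_in_Con] by auto

text \<open>The index \<open>i\<close> is its own witness, as \<open>p i i\<close> is the identity
  on \<open>A i\<close>.\<close>

lemma Psi_subset_theta_fam:
  assumes "C \<in> semilattice_Con"
  shows "Psi ar A p R i \<subseteq> theta_fam ar A p C R i"
proof clarify
  fix a b
  assume ab: "(a, b) \<in> Psi ar A p R i"
  then have "a \<in> univ (A i)" "b \<in> univ (A i)"
    using Con_carrier[OF Psi_in_Con] by blast+
  then show "(a, b) \<in> theta_fam ar A p C R i"
    unfolding theta_fam_iff using ab p_id semilattice_Con_refl[OF assms] by (auto intro!: exI[of _ i])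
qed

lemma theta_fam_in_Con:
  assumes C: "C \<in> semilattice_Con"
  shows "theta_fam ar A p C R i \<in> Con ar (A i)"
proof -
  let ?P = "\<lambda>k. {(a, b). a \<in> univ (A i) \<and> b \<in> univ (A i) \<and> (p i k a, p i k b) \<in> Psi ar A p R k}"
  let ?K = "{k. i \<le> k \<and> (i, k) \<in> C}"
  \<comment> \<open>Preimages grow with the index, so \<open>sup k l\<close> bounds two of them; the
    next fact keeps this join in the class of \<open>i\<close>. Together they give
    directedness.\<close>
  have mono: "?P k \<subseteq> ?P l" if "i \<le> k" "k \<le> l" for k l
    using Psi_push[OF that(2)] p_comp[OF that] by fastforce
  have sup: "sup k l \<in> ?K" if "k \<in> ?K" "l \<in> ?K" for k l
    using that semilattice_Con_sup[OF C, of i k i l] by (auto intro: le_supI1)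
  have "\<Union>(?P ` ?K) \<in> Con ar (A i)"
  proof (rule Union_directed_in_Con)
    show "?P ` ?K \<noteq> {}"
      using semilattice_Con_refl[OF C] by blast
    show "?P ` ?K \<subseteq> Con ar (A i)"
      using vimage_in_Con[OF algebra_A hom_p Psi_in_Con] by blast
    fix X Y
    assume "X \<in> ?P ` ?K" "Y \<in> ?P ` ?K"
    then obtain k l where kl: "k \<in> ?K" "X = ?P k" "l \<in> ?K" "Y = ?P l"
      by blast
    then have "X \<union> Y \<subseteq> ?P (sup k l)"
      using mono[OF _ sup_ge1, of k l] mono[OF _ sup_ge2, of l k] by simp
    then show "\<exists>Z\<in>?P ` ?K. X \<union> Y \<subseteq> Z"
      using sup kl by blast
  qed
  moreover have "theta_fam ar A p C R i = \<Union>(?P ` ?K)"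
    by (auto simp: theta_fam_iff)
  ultimately show ?thesis
    by simp
qed

text \<open>A witness \<open>k\<close> for \<open>i\<close> becomes the witness
  \<open>sup j k\<close> for \<open>j\<close>: joining \<open>(j, j)\<close> with
  \<open>(i, k)\<close> gives \<open>(j, sup j k)\<close> because \<open>i \<le> j\<close>.\<close>

lemma theta_fam_push:
  assumes C: "C \<in> semilattice_Con" and "i \<le> j" "(a, b) \<in> theta_fam ar A p C R i"
  shows "(p i j a, p i j b) \<in> theta_fam ar A p C R j"
proof -
  obtain k where k: "i \<le> k" "(i, k) \<in> C" "(p i k a, p i k b) \<in> Psi ar A p R k"
    and ab: "a \<in> univ (A i)" "b \<in> univ (A i)"
    using assms(3) unfolding theta_fam_iff by blast
  have "(j, sup j k) \<in> C"
    using semilattice_Con_sup[OF C semilattice_Con_refl[OF C, of j] k(2)] assms(2)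
    by (simp add: sup_absorb1)
  moreover have "(p j (sup j k) (p i j a), p j (sup j k) (p i j b)) \<in> Psi ar A p R (sup j k)"
    using Psi_push[OF sup_ge2 k(3), of j] p_comp[OF k(1) sup_ge2] p_comp[OF assms(2) sup_ge1] ab
    by simp
  ultimately show ?thesis
    unfolding theta_fam_iff using p_closed[OF assms(2)] ab by (auto intro!: exI[of _ "sup j k"])
qed

text \<open>A witness for \<open>j\<close> also serves \<open>i\<close>, by transitivity of
  \<open>C\<close> and of the order.\<close>

lemma theta_fam_pull:
  assumes C: "C \<in> semilattice_Con" and "i \<le> j" "(i, j) \<in> C" "a \<in> univ (A i)" "b \<in> univ (A i)"
    and "(p i j a, p i j b) \<in> theta_fam ar A p C R j"
  shows "(a, b) \<in> theta_fam ar A p C R i"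
proof -
  obtain k where k: "j \<le> k" "(j, k) \<in> C"
    "(p j k (p i j a), p j k (p i j b)) \<in> Psi ar A p R k"
    using assms(6) unfolding theta_fam_iff by blast
  then have "i \<le> k" "(i, k) \<in> C" "(p i k a, p i k b) \<in> Psi ar A p R k"
    using p_comp assms semilattice_Con_trans by auto
  then show ?thesis
    unfolding theta_fam_iff using assms by blast
qed

lemma system_congruence_theta_fam:
  assumes C: "C \<in> semilattice_Con"
  shows "system_congruence ar A p C (theta_fam ar A p C R)"
proof -
  let ?\<theta> = "theta_fam ar A p C R"
  have push: "?\<theta> i \<subseteq> {(a, b). a \<in> univ (A i) \<and> b \<in> univ (A i) \<and>
      (p i (sup i j) a, p i (sup i j) b) \<in> ?\<theta> (sup i j)}" for i j
    using theta_fam_push[OF C sup_ge1] Con_carrier[OF theta_fam_in_Con[OF C]] by blast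
  have "?\<theta> i = {(a, b). a \<in> univ (A i) \<and> b \<in> univ (A i) \<and>
      (p i (sup i j) a, p i (sup i j) b) \<in> ?\<theta> (sup i j)}" if "(i, j) \<in> S_fam A p C ?\<theta>" for i j
  proof -
    \<comment> \<open>This places \<open>i\<close> and the join in one class, so condition (iv)
      follows from the comparable case.\<close>
    have "(i, sup i j) \<in> C"
      using that semilattice_Con_sup_left[OF C] unfolding S_fam_def by blast
    then show ?thesis
      using push[of i j] theta_fam_pull[OF C sup_ge1] by blast
  qed
  then show ?thesis
    unfolding system_congruence_def using C theta_fam_in_Con[OF C] push by blast
qed

text \<open>A pair of \<open>R\<close> becomes a generator of \<Psi> at the join of its two indices,
  and \<Psi> is contained in \<theta>; the indices are \<open>C\<close>-related because
  \<open>S_rel A R \<subseteq> C\<close>.\<close>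

lemma subset_assoc_congruence_theta_fam:
  assumes "R \<subseteq> univ (plonka_sum A p) \<times> univ (plonka_sum A p)"
    and C: "C \<in> semilattice_Con" and S: "S_rel A R \<subseteq> C"
  shows "R \<subseteq> assoc_congruence A p C (theta_fam ar A p C R)"
proof clarify
  fix a b
  assume ab: "(a, b) \<in> R"
  then obtain u v where uv: "a \<in> univ (A u)" "b \<in> univ (A v)"
    using assms(1) unfolding univ_plonka_sum by blast
  then have "(u, v) \<in> C"
    using S ab unfolding S_rel_def by blast
  then show "(a, b) \<in> assoc_congruence A p C (theta_fam ar A p C R)"
    using assoc_congruence_iff[OF uv] Psi_base[OF ab uv sup_ge1 sup_ge2]
      Psi_subset_theta_fam[OF C] by blast
qed

end

theorem theorem11:
  fixes ar :: "'f \<Rightarrow> nat"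
    and V :: "('f, 'a) alg set"
    and A :: "'i::semilattice_sup \<Rightarrow> ('f, 'a) alg"
    and p :: "'i \<Rightarrow> 'i \<Rightarrow> 'a \<Rightarrow> 'a"
  assumes "plural ar"
    and "variety ar V"
    and "strongly_irregular ar V"
    and "direct_system ar A p"
    and "\<And>i. A i \<in> V"
  shows "(\<forall>(R :: 'a rel) (C :: 'i rel).
            R \<subseteq> univ (plonka_sum A p) \<times> univ (plonka_sum A p) \<longrightarrow>
            C \<in> semilattice_Con \<longrightarrow> S_rel A R \<subseteq> C \<longrightarrow>
              (\<forall>i. theta_fam ar A p C R i \<in> Con ar (A i)) \<and>
              system_congruence ar A p C (theta_fam ar A p C R) \<and>
              assoc_congruence A p C (theta_fam ar A p C R) \<in> Con ar (plonka_sum A p) \<and>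
              R \<subseteq> assoc_congruence A p C (theta_fam ar A p C R)) \<and>
         (\<forall>C \<in> (semilattice_Con :: 'i rel set).
            \<exists>\<theta> \<in> Con ar (plonka_sum A p). C_rel A \<theta> = C)"
proof -
  interpret semilattice_system ar A p
    by unfold_locales (rule assms(4))
  \<comment> \<open>Any system congruence with first component \<open>C\<close> recovers
    \<open>C\<close> from its associated congruence; the empty relation supplies one.\<close>
  have "\<exists>\<theta>\<in>Con ar (plonka_sum A p). C_rel A \<theta> = C" if "C \<in> semilattice_Con" for C
    using system_congruence_theta_fam[OF that, of "{}"] assoc_congruence_in_Con
      C_rel_assoc_congruence by blast
  then show ?thesis
    by (intro conjI allI impI ballI theta_fam_in_Con system_congruence_theta_fam
        assoc_congruence_in_Con subset_assoc_congruence_theta_fam)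
qed

end
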